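(* Let $\lambda_1=2$ and $\lambda_2=-1$. For every $n\in\mathbb{N}$, $$Gm_n=\left(2+\frac{3i}{2}\right)S_n(\lambda_1+[-\lambda_2])-\left(\frac{5i}{2}+3\right)S_{n-1}(\lambda_1+[-\lambda_2]).$$
   Context: Here $i$ is the imaginary unit. The Gaussian Mersenne Lucas numbers $\{Gm_n\}_{n\ge 0}$ are the complex numbers defined by $Gm_0 = 2+\frac{3i}{2}$, $Gm_1 = 3+2i$, and $Gm_n = 3Gm_{n-1}-2Gm_{n-2}$ for $n\ge 2$. For numbers $a,b$, the symmetric functions $S_n(a+b)$ are defined by $\sum_{n=0}^\infty S_n(a+b)z^n=\frac{1}{(1-az)(1-bz)}$ and $S_n(a+b)=0$ for $n<0$; for $a\ne b$ and $n\ge 0$ this gives $S_n(a+b)=\frac{a^{n+1}-b^{n+1}}{a-b}$. The notation $S_n(\lambda_1+[-\lambda_2])$ means $S_n(a+b)$ with $a=\lambda_1$, $b=-\lambda_2$, so that $\sum_{n=0}^\infty S_n(\lambda_1+[-\lambda_2])z^n=\frac{1}{1-(\lambda_1-\lambda_2)z-\lambda_1\lambda_2z^2}$. *)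

theory Defs
  imports Complex_Main "HOL-Computational_Algebra.Formal_Power_Series"
begin

fun gaussian_mersenne_lucas :: "nat \<Rightarrow> complex" where
  "gaussian_mersenne_lucas 0 = 2 + 3 * \<i> / 2"
| "gaussian_mersenne_lucas (Suc 0) = 3 + 2 * \<i>"
| "gaussian_mersenne_lucas (Suc (Suc n)) =
     3 * gaussian_mersenne_lucas (Suc n) - 2 * gaussian_mersenne_lucas n"

text \<open>
  The symmetric function \<open>S\<^sub>n(a + b)\<close>, the coefficient of \<open>z\<^sup>n\<close> in the formal power series
  \<open>1 / ((1 - a z) (1 - b z))\<close>. It depends on the two-letter alphabet \<open>a, b\<close>, not on the sum
  of the two numbers, so \<open>a\<close> and \<open>b\<close> are separate arguments; \<open>S\<^sub>n(a + [-b])\<close> is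
  \<open>sym_S a (- b) n\<close>.
\<close>

definition sym_S :: "complex \<Rightarrow> complex \<Rightarrow> int \<Rightarrow> complex" where
  "sym_S a b n =
     (if n < 0 then 0
      else fps_nth (1 / ((1 - fps_const a * fps_X) * (1 - fps_const b * fps_X))) (nat n))"

end

theory Submission imports Defs begin

text \<open>
  Multiplying the generating function of \<open>S\<^sub>n(a + b)\<close> by \<open>(1 - a z) (1 - b z)\<close> gives \<open>1\<close>, so
  the sequence \<open>S\<^sub>n(a + b)\<close> obeys the linear recurrence with characteristic roots \<open>a\<close> and \<open>b\<close>,
  started from \<open>S\<^sub>-\<^sub>1 = 0\<close> and \<open>S\<^sub>0 = 1\<close>. Hence \<open>S\<^sub>n\<close> and \<open>S\<^sub>n\<^sub>-\<^sub>1\<close> span all solutions of that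
  recurrence, and the coefficients are read off from the first two terms
  (\<open>binary_recurrence_eq_sym_S\<close>). The Gaussian Mersenne Lucas recurrence has characteristic
  polynomial \<open>x\<^sup>2 - 3 x + 2 = (x - 2) (x - 1)\<close>, so \<open>a = 2\<close> and \<open>b = 1\<close>.
\<close>

lemma linear_factor_mult_nth_Suc:
  fixes F :: "'a::comm_ring_1 fps"
  shows "fps_nth ((1 - fps_const c * fps_X) * F) (Suc n) = fps_nth F (Suc n) - c * fps_nth F n"
  by (simp add: left_diff_distrib mult.assoc)

lemma sym_S_neg: "n < 0 \<Longrightarrow> sym_S a b n = 0"
  by (simp add: sym_S_def)

lemma sym_S_0: "sym_S a b 0 = 1"
  by (simp add: sym_S_def fps_divide_unit)

text \<open>
  The right-hand side starts at index \<open>-1\<close> for \<open>n = 0\<close>, where the convention that \<open>S\<close> vanishes at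
  negative indices makes the recurrence hold one step earlier than the coefficients alone suggest.
\<close>

lemma sym_S_Suc:
  "sym_S a b (int (Suc n)) = (a + b) * sym_S a b (int n) - a * b * sym_S a b (int n - 1)"
proof -
  define P :: "complex fps" where "P = (1 - fps_const a * fps_X) * (1 - fps_const b * fps_X)"
  define F where "F = 1 / P"
  define G where "G = (1 - fps_const b * fps_X) * F"
  have "fps_nth P 0 \<noteq> 0"
    by (simp add: P_def)
  then have "P * F = 1"
    by (simp add: F_def fps_divide_unit inverse_mult_eq_1')
  then have one: "(1 - fps_const a * fps_X) * G = 1"
    by (simp add: P_def G_def mult.assoc)
  have S: "sym_S a b (int k) = fps_nth F k" for k
    by (simp add: sym_S_def F_def P_def)
  have "fps_nth G (Suc n) = a * fps_nth G n"
    using linear_factor_mult_nth_Suc[of a G n] by (simp add: one)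
  then have G_Suc: "fps_nth F (Suc n) - b * fps_nth F n = a * fps_nth G n"
    by (simp add: G_def linear_factor_mult_nth_Suc)
  show ?thesis
  proof (cases n)
    case 0
    have "fps_nth G 0 = fps_nth F 0"
      by (simp add: G_def)
    with G_Suc 0 show ?thesis
      unfolding S by (simp add: sym_S_neg algebra_simps)
  next
    case (Suc k)
    have "int n - 1 = int k"
      using Suc by simp
    moreover have "fps_nth G n = fps_nth F n - b * fps_nth F k"
      by (simp add: G_def Suc linear_factor_mult_nth_Suc)
    ultimately show ?thesis
      using G_Suc by (simp only: S) (simp add: algebra_simps)
  qed
qed

text \<open>
  Both sides satisfy the same second-order recurrence, so only the first two terms need to
  agree. Since \<open>S\<^sub>1 = a + b\<close>, the value at \<open>1\<close> forces the coefficient \<open>u\<^sub>1 - (a + b) u\<^sub>0\<close> of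
  \<open>S\<^sub>n\<^sub>-\<^sub>1\<close>.
\<close>

lemma binary_recurrence_eq_sym_S:
  fixes u :: "nat \<Rightarrow> complex"
  assumes rec: "\<And>n. u (Suc (Suc n)) = (a + b) * u (Suc n) - a * b * u n"
  shows "u n = u 0 * sym_S a b (int n) + (u 1 - (a + b) * u 0) * sym_S a b (int n - 1)"
proof (induction n rule: induct_nat_012)
  case 0
  show ?case
    by (simp add: sym_S_0 sym_S_neg)
next
  case 1
  show ?case
    using sym_S_Suc[of a b 0] by (simp add: sym_S_0 sym_S_neg)
next
  case (ge2 n)
  have "int (Suc n) - 1 = int n" "int (Suc (Suc n)) - 1 = int (Suc n)"
    by simp_all
  with ge2 show ?case
    by (simp only: rec sym_S_Suc) (simp add: algebra_simps)
qed

theorem theorem5: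
  fixes lambda1 lambda2 :: complex and n :: nat
  assumes "lambda1 = 2" and "lambda2 = -1"
  shows "gaussian_mersenne_lucas n =
    (2 + 3 * \<i> / 2) * sym_S lambda1 (- lambda2) (int n)
    - (5 * \<i> / 2 + 3) * sym_S lambda1 (- lambda2) (int n - 1)"
proof -
  have "gaussian_mersenne_lucas 1 - (2 + 1) * gaussian_mersenne_lucas 0 = - (5 * \<i> / 2 + 3)"
    by (simp add: algebra_simps)
  with binary_recurrence_eq_sym_S[of gaussian_mersenne_lucas 2 1 n] show ?thesis
    using assms by (simp add: algebra_simps)
qed

end
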